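(* Let $k\ge 2$ be a fixed integer, and let $G$ be a $k$-tree that contains a path on $n$ vertices. Then $G$ contains an induced path of size $\frac{\log (n-k-1)}{k \log k}=\frac{\log n}{k \log k}-O(\frac{1}{n})$.
   Context: The class of $k$-trees is defined recursively: any clique on $k$ vertices is a $k$-tree; and if $G$ has a vertex $v$ whose neighborhood is a clique of size exactly $k$ (a $k$-simplicial vertex) and $G\setminus v$ is a $k$-tree, then $G$ is a $k$-tree. The size of a path is its number of vertices. An induced path is a path that is an induced subgraph. Logarithms are base 2. *)

theory Defs
  imports Complex_Main "HOL-Library.Landau_Symbols"
begin

definition simple_graph :: "'a set \<Rightarrow> 'a set set \<Rightarrow> bool" where
  "simple_graph V E \<longleftrightarrow> finite V \<and> (\<forall>e\<in>E. e \<subseteq> V \<and> card e = 2)"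

definition neighborhood :: "'a set set \<Rightarrow> 'a \<Rightarrow> 'a set" where
  "neighborhood E v = {u. {u, v} \<in> E}"

definition clique :: "'a set set \<Rightarrow> 'a set \<Rightarrow> bool" where
  "clique E K \<longleftrightarrow> (\<forall>u\<in>K. \<forall>v\<in>K. u \<noteq> v \<longrightarrow> {u, v} \<in> E)"

definition induced_edges :: "'a set set \<Rightarrow> 'a set \<Rightarrow> 'a set set" where
  "induced_edges E S = {e \<in> E. e \<subseteq> S}"

definition simplicial :: "nat \<Rightarrow> 'a set set \<Rightarrow> 'a \<Rightarrow> bool" where
  "simplicial k E v \<longleftrightarrow> clique E (neighborhood E v) \<and> card (neighborhood E v) = k"

inductive ktree :: "nat \<Rightarrow> 'a set \<Rightarrow> 'a set set \<Rightarrow> bool" for k where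
  base: "simple_graph V E \<Longrightarrow> clique E V \<Longrightarrow> card V = k \<Longrightarrow> ktree k V E"
| extend: "simple_graph V E \<Longrightarrow> v \<in> V \<Longrightarrow> simplicial k E v \<Longrightarrow>
    ktree k (V - {v}) (induced_edges E (V - {v})) \<Longrightarrow> ktree k V E"

text \<open>A path is given by the list of its vertices in order, so its size is the length of the list.\<close>

definition path_edges :: "'a list \<Rightarrow> 'a set set" where
  "path_edges p = {{p ! i, p ! Suc i} | i. Suc i < length p}"

definition is_path :: "'a set \<Rightarrow> 'a set set \<Rightarrow> 'a list \<Rightarrow> bool" where
  "is_path V E p \<longleftrightarrow> p \<noteq> [] \<and> distinct p \<and> set p \<subseteq> V \<and> path_edges p \<subseteq> E"

definition is_induced_path :: "'a set \<Rightarrow> 'a set set \<Rightarrow> 'a list \<Rightarrow> bool" where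
  "is_induced_path V E p \<longleftrightarrow> is_path V E p \<and> induced_edges E (set p) = path_edges p"

end

theory Submission imports Defs "HOL-Real_Asymp.Real_Asymp"
begin

text \<open>
  Keep a \<open>k\<close>-clique \<open>S\<close>, for every \<open>s \<in> S\<close> an induced path ending in \<open>s\<close>, and a path \<open>Q\<close> avoiding
  \<open>S\<close> whose component \<open>C\<close> of \<open>G - S\<close> is anticomplete to all those induced paths except for their last
  vertices. In a \<open>k\<close>-tree some \<open>v \<in> C\<close> is adjacent to all of \<open>S\<close>. The longer part \<open>Q'\<close> of \<open>Q - v\<close> lies
  in a component of \<open>G - S - v\<close> that misses the neighbourhood of some \<open>u \<in> S\<close>. Replace \<open>u\<close> by \<open>v\<close> in
  \<open>S\<close>, append \<open>v\<close> to the induced path of \<open>u\<close>, and continue with \<open>Q'\<close>. Each round halves \<open>Q\<close> at worst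
  and increases the total length of the \<open>k\<close> induced paths by one.
\<close>

section \<open>Reachability inside a vertex set\<close>

text \<open>Its reflexive transitive closure encodes the components of the subgraph induced on
  \<open>X\<close>. The closure also relates a vertex outside \<open>X\<close> to itself, so
  membership of the start in \<open>X\<close> has to be assumed separately.\<close>

definition adj_in :: "'a set set \<Rightarrow> 'a set \<Rightarrow> ('a \<times> 'a) set" where
  "adj_in E X = {(a, b). a \<in> X \<and> b \<in> X \<and> {a, b} \<in> E}"

lemma adj_in_mono: "E \<subseteq> E' \<Longrightarrow> X \<subseteq> Y \<Longrightarrow> adj_in E X \<subseteq> adj_in E' Y"
  by (auto simp: adj_in_def)

lemma adj_in_rtrancl_mono:
  "(x, y) \<in> (adj_in E X)\<^sup>* \<Longrightarrow> E \<subseteq> E' \<Longrightarrow> X \<subseteq> Y \<Longrightarrow> (x, y) \<in> (adj_in E' Y)\<^sup>*"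
  using rtrancl_mono[OF adj_in_mono] by blast

lemma adj_in_rtrancl_mem: "(x, y) \<in> (adj_in E X)\<^sup>* \<Longrightarrow> x \<in> X \<Longrightarrow> y \<in> X"
  by (induction rule: rtrancl_induct) (auto simp: adj_in_def)

lemma adj_in_rtrancl_sym: "(x, y) \<in> (adj_in E X)\<^sup>* \<Longrightarrow> (y, x) \<in> (adj_in E X)\<^sup>*"
  by (rule symD[OF sym_rtrancl]) (auto simp: sym_def adj_in_def insert_commute)

text \<open>Take \<open>y\<close> just before the first visit of the walk to \<open>v\<close>. The
  induction maintains that the walk has avoided \<open>v\<close> so far or that such a
  \<open>y\<close> has been found.\<close>

lemma adj_in_rtrancl_neighbour:
  assumes "(x, v) \<in> (adj_in E X)\<^sup>*" "x \<noteq> v"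
  shows "\<exists>y. (x, y) \<in> (adj_in E (X - {v}))\<^sup>* \<and> {v, y} \<in> E"
proof -
  have "(x, z) \<in> (adj_in E (X - {v}))\<^sup>* \<and> z \<noteq> v
      \<or> (\<exists>y. (x, y) \<in> (adj_in E (X - {v}))\<^sup>* \<and> {v, y} \<in> E)"
    if "(x, z) \<in> (adj_in E X)\<^sup>*" for z
    using that
  proof (induction rule: rtrancl_induct)
    case base
    then show ?case using assms(2) by blast
  next
    case (step y z)
    show ?case
    proof (cases "(x, y) \<in> (adj_in E (X - {v}))\<^sup>* \<and> y \<noteq> v")
      case True
      show ?thesis
      proof (cases "z = v")
        case True
        then show ?thesis using step(2) \<open>_ \<and> y \<noteq> v\<close> by (auto simp: adj_in_def insert_commute)
      next
        case False
        then have "(y, z) \<in> adj_in E (X - {v})" using step(2) True by (auto simp: adj_in_def)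
        then show ?thesis using True False by (meson rtrancl.rtrancl_into_rtrancl)
      qed
    next
      case False
      then show ?thesis using step(3) by blast
    qed
  qed
  from this[OF assms(1)] show ?thesis by blast
qed

text \<open>A walk could enter \<open>u\<close> only from a vertex already reached without
  \<open>u\<close>, and \<open>isolated\<close> forbids such an edge.\<close>

lemma adj_in_rtrancl_remove_isolated:
  assumes "(x, y) \<in> (adj_in E X)\<^sup>*" "x \<in> X" "x \<noteq> u"
    and isolated: "\<And>z. (x, z) \<in> (adj_in E (X - {u}))\<^sup>* \<Longrightarrow> {u, z} \<notin> E"
  shows "(x, y) \<in> (adj_in E (X - {u}))\<^sup>*"
  using assms(1)
proof (induction rule: rtrancl_induct)
  case (step y z)
  have "y \<noteq> u" using adj_in_rtrancl_mem[OF step(3)] assms(2,3) by blast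
  moreover have "z \<noteq> u"
    using isolated[OF step(3)] step(2) by (auto simp: adj_in_def insert_commute)
  ultimately have "(y, z) \<in> adj_in E (X - {u})" using step(2) by (auto simp: adj_in_def)
  with step(3) show ?case by (rule rtrancl_into_rtrancl)
qed simp

lemma walk_reachable:
  assumes "successively (\<lambda>a b. {a, b} \<in> E) p" "set p \<subseteq> X" "a \<in> set p"
  shows "(hd p, a) \<in> (adj_in E X)\<^sup>*"
  using assms
proof (induction p rule: induct_list012)
  case (3 x y zs)
  show ?case
  proof (cases "a = x")
    case False
    then have "(y, a) \<in> (adj_in E X)\<^sup>*" using 3 by auto
    moreover have "(x, y) \<in> adj_in E X" using 3 by (auto simp: adj_in_def)
    ultimately show ?thesis by (simp add: converse_rtrancl_into_rtrancl)
  qed simp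
qed auto

section \<open>Paths and their extension by one vertex\<close>

lemma path_edges_subset_iff:
  "path_edges p \<subseteq> E \<longleftrightarrow> successively (\<lambda>a b. {a, b} \<in> E) p"
  by (auto simp: path_edges_def successively_conv_nth)

lemma path_edges_snoc:
  assumes "p \<noteq> []"
  shows "path_edges (p @ [v]) = insert {last p, v} (path_edges p)"
proof -
  have "path_edges (p @ [v]) = (\<lambda>i. {(p @ [v]) ! i, (p @ [v]) ! Suc i}) ` {i. i < length p}"
    by (auto simp: path_edges_def)
  also have "{i. i < length p} = insert (length p - 1) {i. Suc i < length p}"
    using assms by (cases p) auto
  also have "(\<lambda>i. {(p @ [v]) ! i, (p @ [v]) ! Suc i}) ` \<dots>
      = insert {last p, v} ((\<lambda>i. {(p @ [v]) ! i, (p @ [v]) ! Suc i}) ` {i. Suc i < length p})"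
    using assms by (auto simp: nth_append last_conv_nth)
  also have "(\<lambda>i. {(p @ [v]) ! i, (p @ [v]) ! Suc i}) ` {i. Suc i < length p}
      = (\<lambda>i. {p ! i, p ! Suc i}) ` {i. Suc i < length p}"
    by (rule image_cong) (auto simp: nth_append)
  also have "\<dots> = path_edges p" by (auto simp: path_edges_def)
  finally show ?thesis .
qed

lemma is_induced_path_singleton:
  assumes "simple_graph V E" "v \<in> V"
  shows "is_induced_path V E [v]"
proof -
  have "\<not> e \<subseteq> {v}" if "e \<in> E" for e
  proof
    assume "e \<subseteq> {v}"
    then have "card e \<le> 1" using card_mono[of "{v}" e] by simp
    then show False using assms(1) that by (auto simp: simple_graph_def)
  qed
  then show ?thesis
    using assms(2) by (auto simp: is_induced_path_def is_path_def induced_edges_def path_edges_def)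
qed

text \<open>An edge that is new on the enlarged vertex set contains \<open>v\<close>, and
  \<open>rest\<close> leaves only \<open>last p\<close> as its other end.\<close>

lemma is_induced_path_snoc:
  assumes "simple_graph V E" "is_induced_path V E p" "v \<in> V" "v \<notin> set p"
    and last: "{last p, v} \<in> E" and rest: "\<And>a. a \<in> set p \<Longrightarrow> a \<noteq> last p \<Longrightarrow> {a, v} \<notin> E"
  shows "is_induced_path V E (p @ [v])"
proof -
  have p: "p \<noteq> []" "distinct p" "set p \<subseteq> V" "path_edges p \<subseteq> E"
    "induced_edges E (set p) = path_edges p"
    using assms(2) by (auto simp: is_induced_path_def is_path_def)
  have with_v: "e = {last p, v}" if e: "e \<in> E" "e \<subseteq> insert v (set p)" "v \<in> e" for e
  proof -
    have "card e = 2" using assms(1) e(1) by (auto simp: simple_graph_def)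
    then obtain a where "e = {a, v}" "a \<noteq> v"
      using e(3) by (auto simp: card_2_iff)
    then show ?thesis using rest[of a] e by auto
  qed
  have "induced_edges E (set (p @ [v])) = insert {last p, v} (induced_edges E (set p))"
  proof (intro equalityI subsetI)
    fix e assume e: "e \<in> induced_edges E (set (p @ [v]))"
    show "e \<in> insert {last p, v} (induced_edges E (set p))"
    proof (cases "v \<in> e")
      case True
      then show ?thesis using e with_v[of e] by (simp add: induced_edges_def)
    next
      case False
      then show ?thesis using e by (auto simp: induced_edges_def)
    qed
  next
    fix e assume "e \<in> insert {last p, v} (induced_edges E (set p))"
    then show "e \<in> induced_edges E (set (p @ [v]))"
      using last p(1) by (auto simp: induced_edges_def)
  qed
  then show ?thesis
    using p assms(3,4) last
    by (auto simp: is_induced_path_def is_path_def path_edges_snoc)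
qed

section \<open>Elementary facts on k-trees and cliques\<close>

lemma ktree_simple_graph: "ktree k V E \<Longrightarrow> simple_graph V E"
  by (erule ktree.cases) simp_all

lemma clique_mono: "clique E K \<Longrightarrow> E \<subseteq> E' \<Longrightarrow> K' \<subseteq> K \<Longrightarrow> clique E' K'"
  by (simp add: clique_def subset_iff)

lemma induced_edges_subset: "induced_edges E S \<subseteq> E"
  by (auto simp: induced_edges_def)

lemma clique_induced_edges: "clique E K \<Longrightarrow> K \<subseteq> S \<Longrightarrow> clique (induced_edges E S) K"
  by (simp add: clique_def induced_edges_def subset_iff)

lemma ktree_contains_clique:
  "ktree k V E \<Longrightarrow> \<exists>S. S \<subseteq> V \<and> clique E S \<and> card S = k"
proof (induction rule: ktree.induct)
  case (base V E)
  then show ?case by blast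
next
  case (extend V E v)
  then obtain S where "S \<subseteq> V - {v}" "clique (induced_edges E (V - {v})) S" "card S = k" by blast
  then show ?case using clique_mono[OF _ induced_edges_subset order_refl] by blast
qed

lemma neighborhood_subset:
  "simple_graph V E \<Longrightarrow> neighborhood E v \<subseteq> V - {v}"
proof
  fix u assume "simple_graph V E" "u \<in> neighborhood E v"
  then have "{u, v} \<subseteq> V" "card {u, v} = 2" by (auto simp: simple_graph_def neighborhood_def)
  then show "u \<in> V - {v}" by (auto simp: card_2_iff)
qed

lemma clique_minus_subset_neighborhood:
  "clique E K \<Longrightarrow> z \<in> K \<Longrightarrow> K - {z} \<subseteq> neighborhood E z"
  by (auto simp: clique_def neighborhood_def)

section \<open>Components left after deleting a clique from a k-tree\<close>

text \<open>Supplies the vertex that enters the clique in each round. Induction on the construction,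
  with \<open>z\<close> the last vertex added. If \<open>z\<close> is outside \<open>S\<close>, the
  induction hypothesis for \<open>S\<close> serves every start other than \<open>z\<close>, and
  \<open>z\<close> itself is complete to \<open>S\<close> or has a neighbour outside
  \<open>S\<close> to start from. If \<open>z\<close> is in \<open>S\<close>, the clique
  \<open>?N\<close> takes the place of \<open>S\<close>.\<close>

lemma ktree_clique_completion:
  assumes "ktree k V E" "S \<subseteq> V" "clique E S" "card S = k" "x \<in> V - S"
  shows "\<exists>v. (x, v) \<in> (adj_in E (V - S))\<^sup>* \<and> (\<forall>s\<in>S. {s, v} \<in> E)"
  using assms
proof (induction arbitrary: S x rule: ktree.induct)
  case (base V E)
  then have "S = V" by (metis card_subset_eq simple_graph_def)
  then show ?case using base by blast
next
  case (extend V E z)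
  let ?N = "neighborhood E z" and ?E = "induced_edges E (V - {z})"
  have fin: "finite V" using extend(1) by (simp add: simple_graph_def)
  have NV: "?N \<subseteq> V - {z}" using neighborhood_subset[OF extend(1)] .
  have N: "clique E ?N" "card ?N = k" using extend(3) by (auto simp: simplicial_def)
  have finS: "finite S" using extend.prems fin finite_subset by blast
  show ?case
  proof (cases "z \<in> S")
    case True
    have sub: "S - {z} \<subseteq> ?N" using clique_minus_subset_neighborhood extend.prems True by metis
    have "k > 0" using True finS extend.prems by (metis card_gt_0_iff empty_iff)
    have "card (?N - (S - {z})) = card ?N - card (S - {z})"
      using sub finS by (intro card_Diff_subset) auto
    also have "\<dots> = 1" using N True finS extend.prems \<open>k > 0\<close> by simp
    \<comment> \<open>\<open>y\<close> is the vertex of \<open>?N\<close> outside \<open>S\<close>.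
      It is complete to \<open>S\<close> because \<open>?N\<close> is a clique and \<open>z\<close>
      is adjacent to all of \<open>?N\<close>.\<close>
    finally obtain y where y: "?N - (S - {z}) = {y}" by (auto simp: card_1_singleton_iff)
    have yz: "y \<noteq> z" "y \<in> V" "y \<notin> S" using NV y by auto
    have eqN: "?N = insert y (S - {z})" using sub y by blast
    have adjy: "{s, y} \<in> E" if "s \<in> S" for s
    proof (cases "s = z")
      case True
      then show ?thesis using eqN by (auto simp: neighborhood_def insert_commute)
    next
      case False
      then have "s \<in> ?N" "y \<in> ?N" "s \<noteq> y" using eqN that yz(3) by auto
      then show ?thesis using N(1) by (simp add: clique_def)
    qed
    show ?thesis
    proof (cases "x = y")
      case True
      then show ?thesis using adjy by blast
    next
      case False
      have "x \<in> V - {z} - ?N" using False extend.prems True eqN by blast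
      \<comment> \<open>\<open>S\<close> does not lie in the smaller k-tree, but \<open>?N\<close>
        does. The vertex \<open>v\<close> found for \<open>?N\<close> is adjacent to
        \<open>y\<close>, so the walk can be prolonged to \<open>y\<close>.\<close>
      then obtain v where v: "(x, v) \<in> (adj_in ?E (V - {z} - ?N))\<^sup>*" "\<forall>s\<in>?N. {s, v} \<in> ?E"
        using extend.IH[of ?N x] NV N clique_induced_edges[OF N(1) NV] by blast
      have "v \<in> V - {z} - ?N" using adj_in_rtrancl_mem[OF v(1)] \<open>x \<in> V - {z} - ?N\<close> .
      then have "(v, y) \<in> adj_in E (V - S)"
        using v(2) eqN yz by (auto simp: adj_in_def induced_edges_def insert_commute)
      moreover have "(x, v) \<in> (adj_in E (V - S))\<^sup>*"
        using adj_in_rtrancl_mono[OF v(1) induced_edges_subset] eqN by blast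
      ultimately show ?thesis using adjy by (meson rtrancl_into_rtrancl)
    qed
  next
    case False
    have IH: "\<exists>v. (w, v) \<in> (adj_in E (V - S))\<^sup>* \<and> (\<forall>s\<in>S. {s, v} \<in> E)"
      if w: "w \<in> V - {z} - S" for w
    proof -
      have "S \<subseteq> V - {z}" using False extend.prems by blast
      then obtain v where v: "(w, v) \<in> (adj_in ?E (V - {z} - S))\<^sup>*" "\<forall>s\<in>S. {s, v} \<in> ?E"
        using extend.IH[of S w] w extend.prems(2,3) clique_induced_edges[of E S "V - {z}"] by blast
      then show ?thesis
        using adj_in_rtrancl_mono[OF v(1) induced_edges_subset, of "V - S"] induced_edges_subset by blast
    qed
    show ?thesis
    proof (cases "x = z")
      case xz: True
      show ?thesis
      proof (cases "?N \<subseteq> S")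
        case True
        then have "?N = S" using card_subset_eq[OF finS] N extend.prems by simp
        then show ?thesis using xz by (auto simp: neighborhood_def)
      next
        case False
        then obtain y where y: "y \<in> ?N" "y \<notin> S" by blast
        then have "y \<in> V - {z} - S" using NV by blast
        then obtain v where v: "(y, v) \<in> (adj_in E (V - S))\<^sup>*" "\<forall>s\<in>S. {s, v} \<in> E" using IH by blast
        have "(x, y) \<in> adj_in E (V - S)"
          using y NV xz extend.prems by (auto simp: adj_in_def neighborhood_def insert_commute)
        then show ?thesis using v by (meson converse_rtrancl_into_rtrancl)
      qed
    next
      case False
      then show ?thesis using IH extend.prems by blast
    qed
  qed
qed

text \<open>Supplies the vertex that leaves the clique. Again \<open>z\<close> is the last vertex
  added. If \<open>z\<close> is in \<open>K\<close>, all its neighbours are in \<open>K\<close> and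
  \<open>u = z\<close> works. Otherwise the \<open>u\<close> of the smaller k-tree still works,
  because \<open>z\<close> links only vertices that are adjacent anyway.\<close>

lemma ktree_clique_component_misses:
  assumes "ktree k V E" "K \<subseteq> V" "clique E K" "card K = Suc k" "x \<in> V - K"
  shows "\<exists>u\<in>K. \<forall>y. (x, y) \<in> (adj_in E (V - K))\<^sup>* \<longrightarrow> {u, y} \<notin> E"
  using assms
proof (induction arbitrary: K x rule: ktree.induct)
  case (base V E)
  then have "card K \<le> k" by (metis card_mono simple_graph_def)
  then show ?case using base by simp
next
  case (extend V E z)
  let ?N = "neighborhood E z" and ?E = "induced_edges E (V - {z})"
  have fin: "finite V" using extend(1) by (simp add: simple_graph_def)
  have NV: "?N \<subseteq> V - {z}" using neighborhood_subset[OF extend(1)] .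
  have N: "clique E ?N" "card ?N = k" using extend(3) by (auto simp: simplicial_def)
  have finN: "finite ?N" using NV fin finite_subset by blast
  show ?case
  proof (cases "z \<in> K")
    case True
    have sub: "K - {z} \<subseteq> ?N" using clique_minus_subset_neighborhood extend.prems True by metis
    moreover have "card (K - {z}) = k" using True extend.prems by simp
    ultimately have eqN: "K - {z} = ?N" using card_subset_eq[OF finN] N by simp
    have "{z, y} \<notin> E" if "(x, y) \<in> (adj_in E (V - K))\<^sup>*" for y
    proof
      assume "{z, y} \<in> E"
      then have "y \<in> ?N" by (simp add: neighborhood_def insert_commute)
      then show False using adj_in_rtrancl_mem[OF that] extend.prems eqN by blast
    qed
    then show ?thesis using True by blast
  next
    case False
    have other: "\<exists>u\<in>K. \<forall>y. (w, y) \<in> (adj_in E (V - K))\<^sup>* \<longrightarrow> {u, y} \<notin> E"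
      if w: "w \<in> V - {z} - K" for w
    proof -
      let ?R = "adj_in ?E (V - {z} - K)"
      have "K \<subseteq> V - {z}" using False extend.prems by blast
      then obtain u where u: "u \<in> K" "\<And>y. (w, y) \<in> ?R\<^sup>* \<Longrightarrow> {u, y} \<notin> ?E"
        using extend.IH[of K w] w extend.prems clique_induced_edges[of E K "V - {z}"] by blast
      \<comment> \<open>A walk through the simplicial vertex \<open>z\<close> can be shortcut inside its neighbourhood.\<close>
      have reach: "(y \<noteq> z \<and> (w, y) \<in> ?R\<^sup>*) \<or> (y = z \<and> (\<exists>y'\<in>?N. (w, y') \<in> ?R\<^sup>*))"
        if "(w, y) \<in> (adj_in E (V - K))\<^sup>*" for y
        using that
      proof (induction rule: rtrancl_induct)
        case base
        then show ?case using w by blast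
      next
        case (step y y2)
        have e: "{y, y2} \<in> E" "y \<in> V - K" "y2 \<in> V - K" using step(2) by (auto simp: adj_in_def)
        show ?case
        proof (cases "y = z")
          case True
          then obtain y' where y': "y' \<in> ?N" "(w, y') \<in> ?R\<^sup>*" using step(3) by blast
          have "y2 \<in> ?N" using e True by (simp add: neighborhood_def insert_commute)
          then have "y2 \<noteq> z" using NV by blast
          have "y' \<in> V - {z} - K" using adj_in_rtrancl_mem[OF y'(2)] w by blast
          then have "y' = y2 \<or> (y', y2) \<in> ?R"
            using N(1) y'(1) \<open>y2 \<in> ?N\<close> \<open>y2 \<noteq> z\<close> e(3)
            unfolding clique_def adj_in_def induced_edges_def by blast
          then show ?thesis using y'(2) \<open>y2 \<noteq> z\<close> by (meson rtrancl_into_rtrancl)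
        next
          case False
          then have wy: "(w, y) \<in> ?R\<^sup>*" using step(3) by blast
          show ?thesis
          proof (cases "y2 = z")
            case True
            then show ?thesis using wy e by (auto simp: neighborhood_def)
          next
            case ne: False
            then have "(y, y2) \<in> ?R" using e False by (auto simp: adj_in_def induced_edges_def)
            then show ?thesis using wy ne by (meson rtrancl_into_rtrancl)
          qed
        qed
      qed
      \<comment> \<open>Only \<open>y = z\<close> is in doubt. Then some \<open>y'\<close> in
        \<open>?N\<close> is reached without \<open>z\<close>, and an edge from \<open>u\<close> to
        \<open>z\<close> puts \<open>u\<close> into the clique \<open>?N\<close> too, so
        \<open>u\<close> would be adjacent to \<open>y'\<close>.\<close>
      have "{u, y} \<notin> E" if wy: "(w, y) \<in> (adj_in E (V - K))\<^sup>*" for y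
      proof
        assume uy: "{u, y} \<in> E"
        have uV: "u \<in> V - {z}" using u(1) \<open>K \<subseteq> V - {z}\<close> by blast
        have *: "{u, y'} \<notin> E" if "(w, y') \<in> ?R\<^sup>*" for y'
          using u(2)[OF that] adj_in_rtrancl_mem[OF that w] uV by (auto simp: induced_edges_def)
        then obtain y' where y': "y = z" "y' \<in> ?N" "(w, y') \<in> ?R\<^sup>*" using reach[OF wy] uy by blast
        have "u \<in> ?N" using uy y'(1) by (simp add: neighborhood_def)
        moreover have "u \<noteq> y'" using adj_in_rtrancl_mem[OF y'(3) w] u(1) by blast
        ultimately have "{u, y'} \<in> E" using N(1) y'(2) by (simp add: clique_def)
        then show False using *[OF y'(3)] by blast
      qed
      then show ?thesis using u(1) by blast
    qed
    show ?thesis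
    proof (cases "x = z")
      case xz: True
      show ?thesis
      proof (cases "?N \<subseteq> K")
        case True
        \<comment> \<open>All neighbours of \<open>z\<close> lie in \<open>K\<close>, so its
          component is \<open>z\<close> alone. Any of the \<open>k + 1\<close> vertices of
          \<open>K\<close> outside the \<open>k\<close>-element set \<open>?N\<close> will then
          do.\<close>
        have "(z, y) \<in> (adj_in E (V - K))\<^sup>* \<Longrightarrow> y = z" for y
        proof (induction rule: rtrancl_induct)
          case (step y y2)
          then have "y2 \<in> ?N" "y2 \<notin> K" by (auto simp: adj_in_def neighborhood_def insert_commute)
          then show ?case using True by blast
        qed simp
        moreover obtain u where "u \<in> K" "u \<notin> ?N"
        proof -
          have "\<not> K \<subseteq> ?N" using card_mono[OF finN, of K] N(2) extend.prems by auto
          then show ?thesis using that by blast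
        qed
        ultimately show ?thesis using xz unfolding neighborhood_def by blast
      next
        case False
        then obtain w where w: "w \<in> ?N" "w \<notin> K" by blast
        then have "w \<in> V - {z} - K" using NV by blast
        then obtain u where u: "u \<in> K" "\<forall>y. (w, y) \<in> (adj_in E (V - K))\<^sup>* \<longrightarrow> {u, y} \<notin> E"
          using other by blast
        have "(w, x) \<in> adj_in E (V - K)"
          using w NV xz extend.prems by (auto simp: adj_in_def neighborhood_def)
        then show ?thesis using u by (meson converse_rtrancl_into_rtrancl)
      qed
    next
      case False
      then show ?thesis using other extend.prems by blast
    qed
  qed
qed

section \<open>Deleting vertices from a path and keeping a long piece\<close>

text \<open>Deleting \<open>v\<close> leaves pieces of total length at least
  \<open>2 ^ Suc d - 1\<close>, while two lengths below \<open>2 ^ d\<close> sum to at most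
  \<open>2 ^ Suc d - 2\<close>.\<close>

lemma walk_halve:
  assumes "successively P p" "distinct p" "length p \<ge> 2 ^ Suc d"
  shows "\<exists>q. successively P q \<and> distinct q \<and> set q \<subseteq> set p - {v} \<and> length q \<ge> 2 ^ d"
proof (cases "v \<in> set p")
  case True
  then obtain a b where p: "p = a @ v # b" by (meson split_list)
  then have parts: "successively P a" "successively P b" "distinct a" "distinct b"
    "set a \<subseteq> set p - {v}" "set b \<subseteq> set p - {v}"
    using assms(1,2) by (auto simp: successively_append_iff successively_Cons)
  have "length a \<ge> 2 ^ d \<or> length b \<ge> 2 ^ d" using assms(3) by (auto simp: p)
  then show ?thesis using parts by blast
next
  case False
  then show ?thesis using assms by (intro exI[of _ p]) auto
qed

lemma walk_avoid_set:
  assumes "finite S" "successively P p" "distinct p" "length p \<ge> 2 ^ (d + card S)"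
  shows "\<exists>q. successively P q \<and> distinct q \<and> set q \<subseteq> set p - S \<and> length q \<ge> 2 ^ d"
  using assms
proof (induction S arbitrary: p rule: finite_induct)
  case empty
  then show ?case by auto
next
  case (insert v S)
  then have "length p \<ge> 2 ^ Suc (d + card S)" by simp
  then obtain p' where p': "successively P p'" "distinct p'" "set p' \<subseteq> set p - {v}"
    "length p' \<ge> 2 ^ (d + card S)"
    using walk_halve[OF insert.prems(1,2)] by blast
  then obtain q where "successively P q" "distinct q" "set q \<subseteq> set p' - S" "length q \<ge> 2 ^ d"
    using insert.IH by blast
  then show ?case using p'(3) by blast
qed

section \<open>Growing the induced paths\<close>

text \<open>The sum of the lengths is the measure of progress because there is no control over which
  path grows. In the last hypothesis \<open>a \<noteq> y\<close> keeps later vertices off the paths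
  and the absent edges keep the paths induced; \<open>s\<close> is exempt since new vertices attach
  there.\<close>

lemma ktree_extend_induced_paths:
  assumes kt: "ktree k V E" and "k > 0"
    and "S \<subseteq> V" "clique E S" "card S = k"
    and "successively (\<lambda>a b. {a, b} \<in> E) Q" "distinct Q" "set Q \<subseteq> V - S" "length Q \<ge> 2 ^ d"
    and "\<And>s. s \<in> S \<Longrightarrow> is_induced_path V E (f s) \<and> last (f s) = s"
    and "\<And>s y a. s \<in> S \<Longrightarrow> (hd Q, y) \<in> (adj_in E (V - S))\<^sup>* \<Longrightarrow> a \<in> set (f s) \<Longrightarrow> a \<noteq> s \<Longrightarrow>
           a \<noteq> y \<and> {a, y} \<notin> E"
  shows "\<exists>q. is_induced_path V E q \<and> k * length q \<ge> (\<Sum>s\<in>S. length (f s)) + d + k"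
  using assms(3-)
proof (induction d arbitrary: S Q f)
  case (0 S Q f)
  have "Q \<noteq> []" using "0.prems"(7) by auto
  then have hdQ: "hd Q \<in> V - S" using "0.prems"(6) hd_in_set by blast
  obtain v where v: "(hd Q, v) \<in> (adj_in E (V - S))\<^sup>*" "\<forall>s\<in>S. {s, v} \<in> E"
    using ktree_clique_completion[OF kt "0.prems"(1-3) hdQ] by blast
  have vVS: "v \<in> V - S" using adj_in_rtrancl_mem[OF v(1) hdQ] .
  have finS: "finite S" "S \<noteq> {}" using "0.prems"(3) \<open>k > 0\<close> by (auto intro: card_ge_0_finite)
  \<comment> \<open>A longest path has at least average length and can still be prolonged by
    \<open>v\<close>. This last vertex yields the summand \<open>k\<close>.\<close>
  have "Max ((\<lambda>s. length (f s)) ` S) \<in> (\<lambda>s. length (f s)) ` S" using finS by (intro Max_in) auto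
  then obtain u where u: "u \<in> S" "Max ((\<lambda>s. length (f s)) ` S) = length (f u)" by blast
  have "(\<Sum>s\<in>S. length (f s)) \<le> card S * length (f u)"
    using sum_bounded_above[of S "\<lambda>s. length (f s)" "length (f u)"] finS
    unfolding u(2)[symmetric] by simp
  moreover have "is_induced_path V E (f u @ [v])"
    using "0.prems"(8)[OF u(1)] "0.prems"(9)[OF u(1) v(1)] v(2) vVS u(1)
    by (intro is_induced_path_snoc[OF ktree_simple_graph[OF kt]]) auto
  ultimately show ?case using "0.prems"(3) by (intro exI[of _ "f u @ [v]"]) (simp add: algebra_simps)
next
  case (Suc d S Q f)
  have "Q \<noteq> []" using Suc.prems(7) by auto
  then have hdQ: "hd Q \<in> V - S" using Suc.prems(6) hd_in_set by blast
  obtain v where v: "(hd Q, v) \<in> (adj_in E (V - S))\<^sup>*" "\<forall>s\<in>S. {s, v} \<in> E"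
    using ktree_clique_completion[OF kt Suc.prems(1-3) hdQ] by blast
  have vVS: "v \<in> V - S" using adj_in_rtrancl_mem[OF v(1) hdQ] .
  have finS: "finite S" using Suc.prems(3) \<open>k > 0\<close> by (auto intro: card_ge_0_finite)
  obtain Q' where Q': "successively (\<lambda>a b. {a, b} \<in> E) Q'" "distinct Q'"
    "set Q' \<subseteq> set Q - {v}" "length Q' \<ge> 2 ^ d"
    using walk_halve[OF Suc.prems(4,5,7)] by blast
  have "Q' \<noteq> []" using Q'(4) by auto
  then have "hd Q' \<in> set Q'" by simp
  then have hd': "hd Q' \<in> set Q" "hd Q' \<noteq> v" using Q'(3) by auto
  let ?K = "insert v S"
  have hdK: "hd Q' \<in> V - ?K" using hd' Suc.prems(6) by blast
  have reach': "(hd Q, hd Q') \<in> (adj_in E (V - S))\<^sup>*"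
    using walk_reachable[OF Suc.prems(4,6) hd'(1)] .
  have "clique E ?K" using Suc.prems(2) v(2) by (auto simp: clique_def insert_commute)
  moreover have "card ?K = Suc k" using finS vVS Suc.prems(3) by simp
  moreover have "?K \<subseteq> V" using Suc.prems(1) vVS by blast
  ultimately obtain u where u: "u \<in> ?K" "\<And>y. (hd Q', y) \<in> (adj_in E (V - ?K))\<^sup>* \<Longrightarrow> {u, y} \<notin> E"
    using ktree_clique_component_misses[OF kt _ _ _ hdK] by blast
  \<comment> \<open>\<open>v\<close> and \<open>hd Q'\<close> lie in one component of
    \<open>G - S\<close>, so a walk from \<open>hd Q'\<close> to \<open>v\<close> reaches a
    neighbour of \<open>v\<close> before \<open>v\<close> itself.\<close>
  have "u \<noteq> v"
  proof
    assume "u = v"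
    have "(hd Q', v) \<in> (adj_in E (V - S))\<^sup>*"
      using adj_in_rtrancl_sym[OF reach'] v(1) by (rule rtrancl_trans)
    from adj_in_rtrancl_neighbour[OF this hd'(2)] obtain y
      where "(hd Q', y) \<in> (adj_in E (V - S - {v}))\<^sup>*" "{v, y} \<in> E" by blast
    moreover have "V - S - {v} = V - ?K" by blast
    ultimately show False using u(2)[of y] \<open>u = v\<close> by simp
  qed
  then have uS: "u \<in> S" using u(1) by blast
  let ?S = "insert v (S - {u})" and ?f = "f(v := f u @ [v])"
  \<comment> \<open>The exchange puts \<open>u\<close> back into the graph, but \<open>u\<close> has
    no neighbour in the component of \<open>hd Q'\<close>, so that component does not grow.\<close>
  have reachK: "(hd Q', y) \<in> (adj_in E (V - ?K))\<^sup>*" if "(hd Q', y) \<in> (adj_in E (V - ?S))\<^sup>*" for y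
  proof -
    have eq: "V - ?S - {u} = V - ?K" using uS \<open>u \<noteq> v\<close> by blast
    have "hd Q' \<in> V - ?S" "hd Q' \<noteq> u" using hdK uS by auto
    then show ?thesis using adj_in_rtrancl_remove_isolated[OF that, of u] u(2) unfolding eq by blast
  qed
  have "\<exists>q. is_induced_path V E q \<and> k * length q \<ge> (\<Sum>s\<in>?S. length (?f s)) + d + k"
  proof (rule Suc.IH)
    show "?S \<subseteq> V" using \<open>?K \<subseteq> V\<close> by blast
    show "clique E ?S" by (rule clique_mono[OF \<open>clique E ?K\<close>]) auto
    show "card ?S = k" using finS vVS Suc.prems(3) uS \<open>k > 0\<close> by simp
    show "successively (\<lambda>a b. {a, b} \<in> E) Q'" "distinct Q'" "2 ^ d \<le> length Q'" using Q' by auto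
    show "set Q' \<subseteq> V - ?S" using Q'(3) Suc.prems(6) by blast
  next
    fix s assume s: "s \<in> ?S"
    have "is_induced_path V E (f u @ [v])"
      using Suc.prems(8)[OF uS] Suc.prems(9)[OF uS v(1)] v(2) vVS uS
      by (intro is_induced_path_snoc[OF ktree_simple_graph[OF kt]]) auto
    then show "is_induced_path V E (?f s) \<and> last (?f s) = s"
      using s Suc.prems(8)[of s] by auto
  next
    fix s y a
    assume s: "s \<in> ?S" and y: "(hd Q', y) \<in> (adj_in E (V - ?S))\<^sup>*"
      and a: "a \<in> set (?f s)" "a \<noteq> s"
    have yK: "y \<in> V - ?K" "{u, y} \<notin> E"
      using adj_in_rtrancl_mem[OF reachK[OF y] hdK] u(2)[OF reachK[OF y]] by auto
    have "(hd Q', y) \<in> (adj_in E (V - S))\<^sup>*"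
      using adj_in_rtrancl_mono[OF reachK[OF y] order_refl] by blast
    then have yS: "(hd Q, y) \<in> (adj_in E (V - S))\<^sup>*" using reach' by (meson rtrancl_trans)
    show "a \<noteq> y \<and> {a, y} \<notin> E"
    \<comment> \<open>On the prolonged path the old end \<open>u\<close> has lost its exemption; its
      non-adjacency to \<open>y\<close> comes from the choice of \<open>u\<close>. All other
      vertices are covered by the old invariant.\<close>
    proof (cases "s = v")
      case True
      then have "a \<in> set (f u)" using a by auto
      then show ?thesis using Suc.prems(9)[OF uS yS] yK uS by blast
    next
      case False
      then show ?thesis using Suc.prems(9)[OF _ yS, of s a] s a by auto
    qed
  qed
  moreover have "(\<Sum>s\<in>?S. length (?f s)) = (\<Sum>s\<in>S. length (f s)) + 1"
  proof -
    have "(\<Sum>s\<in>?S. length (?f s)) = length (f u) + 1 + (\<Sum>s\<in>S - {u}. length (?f s))"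
      using finS vVS by (subst sum.insert) auto
    also have "(\<Sum>s\<in>S - {u}. length (?f s)) = (\<Sum>s\<in>S - {u}. length (f s))"
      using vVS by (intro sum.cong) auto
    also have "length (f u) + 1 + \<dots> = (\<Sum>s\<in>S. length (f s)) + 1"
      using sum.remove[OF finS uS, of "\<lambda>s. length (f s)"] by simp
    finally show ?thesis .
  qed
  ultimately show ?case by auto
qed

section \<open>From a long path to a long induced path\<close>

text \<open>Clearing the initial clique \<open>S\<close> off \<open>p\<close> costs \<open>k\<close>
  halvings. The one-vertex paths on \<open>S\<close> satisfy the invariant vacuously, and their
  total length \<open>k\<close> is the second \<open>k\<close> in the bound.\<close>

lemma ktree_induced_path_of_long_path:
  assumes kt: "ktree k V E" and "k > 0" and p: "is_path V E p" "length p \<ge> 2 ^ (d + k)"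
  shows "\<exists>q. is_induced_path V E q \<and> k * length q \<ge> d + 2 * k"
proof -
  obtain S where S: "S \<subseteq> V" "clique E S" "card S = k"
    using ktree_contains_clique[OF kt] by blast
  have finS: "finite S" using S(3) \<open>k > 0\<close> by (auto intro: card_ge_0_finite)
  have p': "successively (\<lambda>a b. {a, b} \<in> E) p" "distinct p" "set p \<subseteq> V"
    using p(1) by (auto simp: is_path_def path_edges_subset_iff)
  obtain Q where Q: "successively (\<lambda>a b. {a, b} \<in> E) Q" "distinct Q" "set Q \<subseteq> set p - S"
    "length Q \<ge> 2 ^ d"
    using walk_avoid_set[OF finS p'(1,2)] p(2) S(3) by blast
  have QV: "set Q \<subseteq> V - S" using Q(3) p'(3) by blast
  have "is_induced_path V E [s]" if "s \<in> S" for s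
    using is_induced_path_singleton[OF ktree_simple_graph[OF kt]] S(1) that by blast
  then have "\<exists>q. is_induced_path V E q \<and> k * length q \<ge> (\<Sum>s\<in>S. length [s]) + d + k"
    by (intro ktree_extend_induced_paths[OF kt \<open>k > 0\<close> S Q(1,2) QV Q(4)]) auto
  then show ?thesis using S(3) by auto
qed

lemma ktree_path_length_bound:
  assumes kt: "ktree k V E" and "k \<ge> 2" and p: "is_path V E p"
  shows "\<exists>q. is_induced_path V E q \<and> length p \<le> k ^ (k * length q)"
proof -
  have "length p > 0" using p by (simp add: is_path_def)
  then obtain m where m: "2 ^ m \<le> length p" "length p < 2 ^ (m + 1)"
    using ex_power_ivl1[of 2 "length p"] by (auto simp: Suc_le_eq)
  \<comment> \<open>For \<open>k \<le> m\<close> the choice \<open>d = m - k\<close> gives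
    \<open>m + k\<close>, which is at least \<open>m + 1\<close>. For \<open>m < k\<close> a single
    vertex suffices.\<close>
  obtain q where q: "is_induced_path V E q" "m + 1 \<le> k * length q"
  proof (cases "k \<le> m")
    case True
    then obtain q where "is_induced_path V E q" "k * length q \<ge> m - k + 2 * k"
      using ktree_induced_path_of_long_path[OF kt _ p, of "m - k"] m(1) \<open>k \<ge> 2\<close> by auto
    then show ?thesis using that[of q] True \<open>k \<ge> 2\<close> by linarith
  next
    case False
    have "hd p \<in> V" using p by (auto simp: is_path_def)
    then have "is_induced_path V E [hd p]"
      using is_induced_path_singleton[OF ktree_simple_graph[OF kt]] by blast
    then show ?thesis using that[of "[hd p]"] False by simp
  qed
  have "length p \<le> 2 ^ (m + 1)" using m(2) by simp
  also have "\<dots> \<le> 2 ^ (k * length q)" using q(2) by (intro power_increasing) auto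
  \<comment> \<open>Base 2 is weakened to base \<open>k\<close> to match the factor
    \<open>log 2 k\<close> in the claimed denominator.\<close>
  also have "\<dots> \<le> k ^ (k * length q)" using \<open>k \<ge> 2\<close> by (intro power_mono) auto
  finally show ?thesis using q(1) by blast
qed

section \<open>Asymptotics and the final bound\<close>

text \<open>For \<open>n > a\<close> the difference is \<open>- log 2 (1 - a / n)\<close>, which is
  of order \<open>a / n\<close>.\<close>

lemma log_diff_bigo:
  fixes a :: real
  assumes "a > 0"
  shows "(\<lambda>n::nat. log 2 (real n) - log 2 (real n - a)) \<in> O(\<lambda>n. 1 / real n)"
  using assms by real_asymp

theorem theorem3:
  fixes k :: nat
  assumes "k \<ge> 2"
  shows "(\<forall>(V :: 'a set) E n. ktree k V E \<longrightarrow> n > k + 1 \<longrightarrow>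
            (\<exists>p. is_path V E p \<and> length p = n) \<longrightarrow>
            (\<exists>q. is_induced_path V E q \<and>
                 real (length q) \<ge> log 2 (real n - real k - 1) / (real k * log 2 (real k)))) \<and>
         (\<lambda>n::nat. log 2 (real n) / (real k * log 2 (real k))
                 - log 2 (real n - real k - 1) / (real k * log 2 (real k)))
           \<in> O(\<lambda>n. 1 / real n)"
proof -
  let ?c = "real k * log 2 (real k)"
  have pos: "?c > 0" using assms by (intro mult_pos_pos) auto
  show ?thesis
  proof (intro conjI allI impI)
    fix V :: "'a set" and E n
    assume kt: "ktree k V E" and n: "n > k + 1" and "\<exists>p. is_path V E p \<and> length p = n"
    then obtain q where q: "is_induced_path V E q" "n \<le> k ^ (k * length q)"
      using ktree_path_length_bound[OF kt assms] by blast
    \<comment> \<open>The left argument is positive by \<open>n > k + 1\<close> and at most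
      \<open>n\<close>.\<close>
    have "log 2 (real n - real k - 1) \<le> log 2 (real (k ^ (k * length q)))"
      using n q(2) by (intro log_mono) linarith+
    also have "\<dots> = real (length q) * (real k * log 2 (real k))"
      using assms by (simp add: log_nat_power)
    finally show "\<exists>q. is_induced_path V E q \<and>
        real (length q) \<ge> log 2 (real n - real k - 1) / (real k * log 2 (real k))"
      using q(1) pos by (auto simp: pos_divide_le_eq)
  next
    have "(\<lambda>n::nat. log 2 (real n) - log 2 (real n - (real k + 1))) \<in> O(\<lambda>n. 1 / real n)"
      by (rule log_diff_bigo) simp
    then have "(\<lambda>n::nat. inverse ?c * (log 2 (real n) - log 2 (real n - (real k + 1)))) \<in> O(\<lambda>n. 1 / real n)"
      using nonzero_imp_inverse_nonzero[OF less_imp_neq[OF pos, symmetric]]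
    by (subst landau_o.big.cmult_in_iff)
    then show "(\<lambda>n::nat. log 2 (real n) / ?c - log 2 (real n - real k - 1) / ?c) \<in> O(\<lambda>n. 1 / real n)"
      by (simp add: divide_inverse algebra_simps)
  qed
qed

end
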